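(* Let $k\subset L=k[x]$ be a finite separable field extension and let $E_1,\dots,E_t$ be its distinct principal subfields. The following two statements are equivalent: (1) $\ell[k,L]=2$; (2) $t>1$ and $E_\alpha\cap E_\beta=k$ for all $\alpha,\beta\in\{1,\dots,t\}$ with $\alpha\neq\beta$. If these statements hold, then: (3) $|[k,L]|=t+1$ if $k$ is one of the $E_\alpha$; (4) $|[k,L]|=t+2$ if $k\neq E_\alpha$ for all $\alpha\in\{1,\dots,t\}$.
   Context: $k\subset L$ is a proper extension; $[k,L]$ is the set of $k$-subalgebras of $L$ (i.e. intermediate fields), and $\ell[k,L]$ is the supremum of the lengths $n$ of chains $K_0\subset K_1\subset\cdots\subset K_n$ in $[k,L]$. Let $f(X)\in k[X]$ be the minimal polynomial of $x$ over $k$ and $f(X)=(X-x)f_1(X)\cdots f_r(X)$ its factorization into monic irreducible polynomials of $L[X]$. For $\alpha\in\{1,\dots,r\}$ let $L_\alpha=\{g(x)\in L\mid g(X)\in k[X],\ f_\alpha(X)\text{ divides }g(X)-g(x)\text{ in }L[X]\}$; the fields $L_\alpha$ are the principal subfields of $k\subset L$. Since different $\alpha$ may give the same field, $\{E_1,\dots,E_t\}$ denotes the set $\{L_1,\dots,L_r\}$, with the $E_\beta$ pairwise distinct. *)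

theory Defs
  imports "HOL-Computational_Algebra.Polynomial" "HOL-Library.Extended_Nat"
begin

text \<open>
  The extension field \<open>L\<close> is the whole of a type \<open>'a\<close> of class \<open>field\<close>; the ground field
  \<open>k\<close> and the intermediate rings are subsets of \<open>'a\<close>, and \<open>L[X]\<close> is \<open>'a poly\<close>.
\<close>

definition is_subring :: "'a::field set \<Rightarrow> bool" where
  "is_subring A \<longleftrightarrow> 1 \<in> A \<and> (\<forall>a\<in>A. \<forall>b\<in>A. a - b \<in> A \<and> a * b \<in> A)"

definition is_subfield :: "'a::field set \<Rightarrow> bool" where
  "is_subfield K \<longleftrightarrow> is_subring K \<and> (\<forall>a\<in>K. a \<noteq> 0 \<longrightarrow> inverse a \<in> K)"

definition polys_over :: "'a::field set \<Rightarrow> 'a poly set" where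
  "polys_over K = {p. \<forall>i. coeff p i \<in> K}"

definition adjoin :: "'a::field set \<Rightarrow> 'a \<Rightarrow> 'a set" where
  "adjoin K x = (\<lambda>g. poly g x) ` polys_over K"

definition finite_extension :: "'a::field set \<Rightarrow> bool" where
  "finite_extension k \<longleftrightarrow>
     (\<exists>B. finite B \<and> (\<forall>y. \<exists>c. (\<forall>b\<in>B. c b \<in> k) \<and> y = (\<Sum>b\<in>B. c b * b)))"

definition is_min_poly :: "'a::field set \<Rightarrow> 'a \<Rightarrow> 'a poly \<Rightarrow> bool" where
  "is_min_poly k y p \<longleftrightarrow>
     p \<in> polys_over k \<and> lead_coeff p = 1 \<and> poly p y = 0 \<and>
     (\<forall>q\<in>polys_over k. q \<noteq> 0 \<and> poly q y = 0 \<longrightarrow> degree p \<le> degree q)"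

text \<open>
  Every element is algebraic with separable minimal polynomial. Coprimality of \<open>p\<close> and its
  derivative is taken in \<open>L[X]\<close>, which is the same as in \<open>k[X]\<close> since a gcd does not change
  under extension of the field.
\<close>

definition separable_extension :: "'a::field set \<Rightarrow> bool" where
  "separable_extension k \<longleftrightarrow> (\<forall>y. \<exists>p. is_min_poly k y p \<and> coprime p (pderiv p))"

text \<open>The set \<open>[k,L]\<close> of \<open>k\<close>-subalgebras of \<open>L\<close>.\<close>

definition subalgebras :: "'a::field set \<Rightarrow> 'a set set" where
  "subalgebras k = {A. is_subring A \<and> k \<subseteq> A}"

definition ext_length :: "'a::field set \<Rightarrow> enat" where
  "ext_length k =
     (SUP n\<in>{n. \<exists>K. (\<forall>i\<le>n. K i \<in> subalgebras k) \<and> (\<forall>i<n. K i \<subset> K (Suc i))}. enat n)"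

definition principal_subfield :: "'a::field set \<Rightarrow> 'a \<Rightarrow> 'a poly \<Rightarrow> 'a set" where
  "principal_subfield k x h = {poly g x | g. g \<in> polys_over k \<and> h dvd (g - [:poly g x:])}"

lemma is_subring_0: "is_subring A \<Longrightarrow> 0 \<in> A"
  unfolding is_subring_def by (metis diff_self)

lemma is_subring_minus: "is_subring A \<Longrightarrow> a \<in> A \<Longrightarrow> - a \<in> A"
  using is_subring_0 unfolding is_subring_def by (metis diff_0)

lemma is_subring_add: "is_subring A \<Longrightarrow> a \<in> A \<Longrightarrow> b \<in> A \<Longrightarrow> a + b \<in> A"
  using is_subring_minus unfolding is_subring_def by (metis diff_minus_eq_add)

lemma poly_in_subring:
  assumes A: "is_subring A" and y: "y \<in> A" and p: "p \<in> polys_over A"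
  shows "poly p y \<in> A"
  using p
proof (induction p)
  case 0
  then show ?case using is_subring_0[OF A] by simp
next
  case (pCons a p)
  have "a \<in> A" "p \<in> polys_over A"
    using pCons.prems unfolding polys_over_def by (auto, metis coeff_pCons_0, metis coeff_pCons_Suc)
  with pCons.IH y A show ?case
    by (simp add: is_subring_add is_subring_def)
qed

text \<open>The \<open>k\<close>-subalgebras of a separable (in particular algebraic) extension are its
  intermediate fields.\<close>

lemma subalgebras_eq_intermediate_fields:
  fixes k :: "'a::field set"
  assumes k: "is_subfield k" and sep: "separable_extension k"
  shows "subalgebras k = {K. is_subfield K \<and> k \<subseteq> K}"
proof -
  have "inverse y \<in> A" if A: "is_subring A" "k \<subseteq> A" and y: "y \<in> A" "y \<noteq> 0" for A y
  proof -
    obtain p where p: "is_min_poly k y p"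
      using sep unfolding separable_extension_def by blast
    obtain a q where pq: "p = pCons a q" by (cases p)
    have pk: "p \<in> polys_over k" and root: "poly p y = 0" and lead: "lead_coeff p = 1"
      using p unfolding is_min_poly_def by auto
    have ak: "a \<in> k" and qk: "q \<in> polys_over k"
      using pk unfolding pq polys_over_def by (auto, metis coeff_pCons_0, metis coeff_pCons_Suc)
    have eq: "a + y * poly q y = 0" using root pq by simp
    have a0: "a \<noteq> 0"
    proof
      assume "a = 0"
      then have "poly q y = 0" using eq y by simp
      moreover have "q \<noteq> 0" using lead pq \<open>a = 0\<close> by auto
      ultimately have "degree p \<le> degree q"
        using p qk unfolding is_min_poly_def by blast
      then show False using pq \<open>q \<noteq> 0\<close> by simp
    qed
    have "q \<in> polys_over A" using qk A unfolding polys_over_def by blast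
    then have "poly q y \<in> A" using A y poly_in_subring by blast
    moreover have "- inverse a \<in> A"
      using k ak a0 A is_subring_minus unfolding is_subfield_def by blast
    ultimately have "- inverse a * poly q y \<in> A" using A unfolding is_subring_def by blast
    moreover have "inverse y = - inverse a * poly q y"
    proof -
      have "y * poly q y = - a" using eq by (simp add: eq_neg_iff_add_eq_0 add.commute)
      then have "poly q y = - a / y" using y by (simp add: field_simps)
      then show ?thesis using a0 y by (simp add: field_simps)
    qed
    ultimately show ?thesis by simp
  qed
  then show ?thesis unfolding subalgebras_def is_subfield_def by blast
qed

end

theory Submission
  imports Defs "HOL-Computational_Algebra.Polynomial_Factorial"
begin

text \<open>
  Let \<open>K\<close> be an intermediate field and \<open>g = (X - x) h\<close> the minimal polynomial of \<open>x\<close> over \<open>K\<close>.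
  An element \<open>p(x)\<close> with \<open>p \<in> k[X]\<close> lies in \<open>K\<close> iff \<open>g\<close> divides \<open>p - p(x)\<close>: the remainder of \<open>p\<close>
  modulo \<open>g\<close> has coefficients in \<open>K\<close>. As \<open>f\<close> is squarefree, this means that every \<open>f\<^sub>\<alpha>\<close>
  dividing \<open>h\<close> divides \<open>p - p(x)\<close>. Hence \<open>K\<close> is the intersection of the \<open>L\<^sub>\<alpha>\<close> with
  \<open>f\<^sub>\<alpha>\<close> dividing \<open>h\<close>. So each proper intermediate field is an intersection of a nonempty family
  of principal subfields, all of which are proper by separability. If distinct ones meet in \<open>k\<close>,
  the only intermediate fields are \<open>k\<close>, \<open>L\<close> and the principal subfields.
\<close>

section \<open>Polynomials over a subring\<close>

lemma polys_over_mono: "A \<subseteq> B \<Longrightarrow> polys_over A \<subseteq> polys_over B"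
  unfolding polys_over_def by blast

lemma polys_over_diff:
  "is_subring A \<Longrightarrow> p \<in> polys_over A \<Longrightarrow> q \<in> polys_over A \<Longrightarrow> p - q \<in> polys_over A"
  unfolding polys_over_def is_subring_def by simp

lemma polys_over_smult:
  "is_subring A \<Longrightarrow> c \<in> A \<Longrightarrow> p \<in> polys_over A \<Longrightarrow> smult c p \<in> polys_over A"
  unfolding polys_over_def is_subring_def by simp

lemma polys_over_pCons_iff: "pCons a p \<in> polys_over A \<longleftrightarrow> a \<in> A \<and> p \<in> polys_over A"
  unfolding polys_over_def by (auto simp: coeff_pCons split: nat.splits)

lemma polys_over_0: "is_subring A \<Longrightarrow> 0 \<in> polys_over A"
  unfolding polys_over_def by (simp add: is_subring_0)

lemma polys_over_mult:
  assumes A: "is_subring A" and p: "p \<in> polys_over A" and q: "q \<in> polys_over A"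
  shows "p * q \<in> polys_over A"
  using p
proof (induction p)
  case 0
  then show ?case by (simp add: polys_over_0[OF A])
next
  case (pCons a p)
  then have "a \<in> A" "p * q \<in> polys_over A" by (auto simp: polys_over_pCons_iff)
  then have "smult a q \<in> polys_over A" "pCons 0 (p * q) \<in> polys_over A"
    using A q by (auto simp: polys_over_smult polys_over_pCons_iff is_subring_0)
  then show ?case
    using A unfolding polys_over_def by (simp add: is_subring_add)
qed

text \<open>Division by a monic polynomial never inverts a coefficient. Thus remainders computed in
  \<open>L[X]\<close> stay over \<open>A\<close>, and no separate division in \<open>A[X]\<close> is
  needed.\<close>

lemma polys_over_mod_monic:
  assumes A: "is_subring A" and p: "p \<in> polys_over A" and g: "g \<in> polys_over A"
    and monic: "lead_coeff g = 1"
  shows "p mod g \<in> polys_over A"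
  using p
proof (induction p)
  case 0
  then show ?case by simp
next
  case (pCons a p)
  then have r: "pCons a (p mod g) \<in> polys_over A" by (simp add: polys_over_pCons_iff)
  have "g \<noteq> 0" using monic by auto
  then have "pCons a p mod g =
      pCons a (p mod g) - smult (coeff (pCons a (p mod g)) (degree g)) g"
    using monic by (simp add: mod_pCons Let_def)
  moreover have "coeff (pCons a (p mod g)) (degree g) \<in> A"
    using r unfolding polys_over_def by blast
  ultimately show ?case
    using A g r by (simp add: polys_over_diff polys_over_smult)
qed

section \<open>Minimal polynomials\<close>

lemma min_poly_degree_pos:
  assumes "is_min_poly K x g"
  shows "degree g > 0"
proof (rule ccontr)
  assume "\<not> degree g > 0"
  then obtain c where "g = [:c:]" using degree_eq_zeroE by auto
  then show False using assms unfolding is_min_poly_def by auto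
qed

text \<open>The remainder \<open>p mod g\<close> is over \<open>K\<close>, vanishes at
  \<open>x\<close> and is zero or of degree below that of \<open>g\<close>; minimality leaves only
  zero.\<close>

lemma min_poly_dvd:
  assumes K: "is_subfield K" and g: "is_min_poly K x g"
    and p: "p \<in> polys_over K" "poly p x = 0"
  shows "g dvd p"
proof -
  have K': "is_subring K" using K by (simp add: is_subfield_def)
  have gK: "g \<in> polys_over K" and lead: "lead_coeff g = 1" and root: "poly g x = 0"
    using g unfolding is_min_poly_def by auto
  have "p mod g \<in> polys_over K" by (rule polys_over_mod_monic[OF K' p(1) gK lead])
  moreover have "poly (p mod g) x = 0"
  proof -
    have "poly p x = poly (p div g) x * poly g x + poly (p mod g) x"
      by (metis div_mult_mod_eq poly_add poly_mult)
    then show ?thesis using p(2) root by simp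
  qed
  moreover have "g \<noteq> 0" using lead by auto
  then have "p mod g = 0 \<or> degree (p mod g) < degree g" by (rule degree_mod_less)
  ultimately have "p mod g = 0" using g unfolding is_min_poly_def by force
  then show ?thesis by auto
qed

lemma min_poly_exists:
  assumes K: "is_subfield K" and f: "f \<in> polys_over K" "f \<noteq> 0" "poly f x = 0"
  obtains g where "is_min_poly K x g"
proof -
  define P where "P p \<longleftrightarrow> p \<in> polys_over K \<and> p \<noteq> 0 \<and> poly p x = 0" for p
  have "P f" using f by (simp add: P_def)
  then obtain h where h: "P h" and least: "\<And>q. P q \<Longrightarrow> degree h \<le> degree q"
    using ex_has_least_nat[of P f degree] by blast
  have h': "h \<in> polys_over K" "h \<noteq> 0" "poly h x = 0" using h by (auto simp: P_def)
  then have "lead_coeff h \<in> K" unfolding polys_over_def by blast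
  then have c: "inverse (lead_coeff h) \<in> K"
    using K h' unfolding is_subfield_def by simp
  have "is_min_poly K x (smult (inverse (lead_coeff h)) h)"
    using K c h' least polys_over_smult
    unfolding is_min_poly_def is_subfield_def P_def by auto
  then show ?thesis by (rule that)
qed

text \<open>If \<open>poly p x\<close> is in \<open>K\<close>, then \<open>p - [:poly p x:]\<close>
  is over \<open>K\<close> and vanishes at \<open>x\<close>. Conversely, divisibility says that the
  constant \<open>poly p x\<close> is the remainder of \<open>p\<close> modulo \<open>g\<close>, and
  this remainder is over \<open>K\<close>.\<close>

lemma mem_iff_min_poly_dvd:
  assumes K: "is_subfield K" and g: "is_min_poly K x g" and p: "p \<in> polys_over K"
  shows "poly p x \<in> K \<longleftrightarrow> g dvd p - [:poly p x:]"
proof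
  have K': "is_subring K" using K by (simp add: is_subfield_def)
  {
    assume "poly p x \<in> K"
    then have "p - [:poly p x:] \<in> polys_over K"
      using K' p by (simp add: polys_over_diff polys_over_pCons_iff polys_over_0)
    then show "g dvd p - [:poly p x:]" using min_poly_dvd[OF K g] by simp
  }
  assume dvd: "g dvd p - [:poly p x:]"
  have gK: "g \<in> polys_over K" and lead: "lead_coeff g = 1"
    using g unfolding is_min_poly_def by auto
  have "p mod g = [:poly p x:] mod g" using dvd by (simp add: mod_eq_dvd_iff)
  also have "\<dots> = [:poly p x:]"
    by (rule mod_poly_less) (simp add: min_poly_degree_pos[OF g])
  finally have "[:poly p x:] \<in> polys_over K"
    using polys_over_mod_monic[OF K' p gK lead] by simp
  then show "poly p x \<in> K" by (simp add: polys_over_pCons_iff)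
qed

section \<open>Squarefree products\<close>

text \<open>By the product rule, a repeated factor of \<open>p\<close> also divides
  \<open>pderiv p\<close>. This is how separability enters.\<close>

lemma not_dvd_squared_of_coprime_pderiv:
  fixes p q :: "'a::field poly"
  assumes "coprime p (pderiv p)" and "\<not> is_unit q"
  shows "\<not> q * q dvd p"
proof
  assume "q * q dvd p"
  then obtain w where "p = q * q * w" by (elim dvdE)
  then have "q dvd p" "q dvd pderiv p"
    by (simp_all add: pderiv_mult algebra_simps)
  then show False using assms coprime_common_divisor by blast
qed

text \<open>A squarefree \<open>h\<close> dividing a product of primes is, up to a unit, a product
  of some of them. The induction removes one prime \<open>p a\<close>: it is split off from
  \<open>h\<close> if it divides \<open>h\<close>, and otherwise it is cancelled from the
  cofactor.\<close>

lemma dvd_of_prime_factors_dvd: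
  fixes h s :: "'a::idom"
  assumes "finite A" and "h dvd prod p A" and "\<And>a. a \<in> A \<Longrightarrow> prime_elem (p a)"
    and "\<And>a. a \<in> A \<Longrightarrow> \<not> p a * p a dvd h"
    and "\<And>a. a \<in> A \<Longrightarrow> p a dvd h \<Longrightarrow> p a dvd s"
  shows "h dvd s"
  using assms
proof (induction A arbitrary: h rule: finite_induct)
  case empty
  then show ?case by (auto intro: dvd_trans)
next
  case (insert a A)
  have prime: "prime_elem (p a)" using insert.prems by simp
  then have nz: "p a \<noteq> 0" by auto
  show ?case
  proof (cases "p a dvd h")
    case True
    then obtain h' where h: "h = p a * h'" by (elim dvdE)
    have "h' dvd s"
    proof (rule insert.IH)
      show "h' dvd prod p A" using insert.prems(1) insert.hyps h nz by simp
    qed (use insert.prems h in \<open>auto intro: dvd_mult\<close>)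
    then obtain w where w: "s = h' * w" by (elim dvdE)
    have "p a dvd h' * w" using insert.prems(4)[of a] True w by simp
    moreover have "\<not> p a dvd h'" using insert.prems(3)[of a] h by auto
    ultimately have "p a dvd w" using prime prime_elem_dvd_mult_iff by blast
    then show ?thesis unfolding h w by (simp add: mult.commute mult_dvd_mono)
  next
    case False
    obtain w where w: "p a * prod p A = h * w"
      using insert.prems(1) insert.hyps by (auto elim: dvdE)
    then have "p a dvd h * w" by (metis dvd_triv_left)
    then obtain v where "w = p a * v" using False prime prime_elem_dvd_mult_iff by (metis dvdE)
    then have "p a * prod p A = p a * (h * v)" using w by (simp add: algebra_simps)
    then have "h dvd prod p A" using nz by simp
    then show ?thesis using insert by auto
  qed
qed

section \<open>Principal subfields\<close>

text \<open>Membership means that some \<open>g\<close> over \<open>k\<close> is congruent to its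
  value at \<open>x\<close> modulo \<open>h\<close>, and congruences may be subtracted and
  multiplied.\<close>

lemma principal_subfield_in_subalgebras:
  assumes k: "is_subfield k"
  shows "principal_subfield k x h \<in> subalgebras k"
proof -
  have k': "is_subring k" using k by (simp add: is_subfield_def)
  have const: "c \<in> principal_subfield k x h" if "c \<in> k" for c
    using that k' unfolding principal_subfield_def
    by (auto intro!: exI[of _ "[:c:]"] simp: polys_over_pCons_iff polys_over_0)
  have "a - b \<in> principal_subfield k x h \<and> a * b \<in> principal_subfield k x h"
    if ab: "a \<in> principal_subfield k x h" "b \<in> principal_subfield k x h" for a b
  proof
    obtain p q where p: "p \<in> polys_over k" "a = poly p x" "h dvd p - [:a:]"
      and q: "q \<in> polys_over k" "b = poly q x" "h dvd q - [:b:]"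
      using ab unfolding principal_subfield_def by auto
    have "p - q - [:a - b:] = (p - [:a:]) - (q - [:b:])" by simp
    then have "h dvd p - q - [:a - b:]" using p q by (metis dvd_diff)
    then show "a - b \<in> principal_subfield k x h"
      using p q k' unfolding principal_subfield_def
      by (auto intro!: exI[of _ "p - q"] simp: polys_over_diff)
    have "p * q - [:a * b:] = p * (q - [:b:]) + [:b:] * (p - [:a:])"
      by (simp add: algebra_simps)
    then have "h dvd p * q - [:a * b:]" using p q by (metis dvd_add dvd_mult)
    then show "a * b \<in> principal_subfield k x h"
      using p q k' unfolding principal_subfield_def
      by (auto intro!: exI[of _ "p * q"] simp: polys_over_mult)
  qed
  moreover have "1 \<in> principal_subfield k x h"
    using const k' unfolding is_subring_def by blast
  ultimately show ?thesis
    using const unfolding subalgebras_def is_subring_def by blast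
qed

text \<open>The choice of \<open>p\<close> is irrelevant: polynomials over \<open>k\<close> with the same value at \<open>x\<close>
  differ by a multiple of \<open>f\<close>.\<close>

lemma poly_mem_principal_subfield_iff:
  assumes k: "is_subfield k" and f: "is_min_poly k x f" and h: "h dvd f"
    and p: "p \<in> polys_over k"
  shows "poly p x \<in> principal_subfield k x h \<longleftrightarrow> h dvd p - [:poly p x:]"
proof
  assume "poly p x \<in> principal_subfield k x h"
  then obtain q where q: "q \<in> polys_over k" "poly p x = poly q x" "h dvd q - [:poly p x:]"
    unfolding principal_subfield_def by auto
  have "p - q \<in> polys_over k"
    using k p q(1) by (simp add: is_subfield_def polys_over_diff)
  then have "f dvd p - q" by (rule min_poly_dvd[OF k f]) (simp add: q(2))
  then have "h dvd p - q" using h dvd_trans by blast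
  then have "h dvd (p - q) + (q - [:poly p x:])" using q(3) by (rule dvd_add)
  then show "h dvd p - [:poly p x:]" by (simp only: add_diff_eq diff_add_cancel)
next
  assume "h dvd p - [:poly p x:]"
  then show "poly p x \<in> principal_subfield k x h"
    using p unfolding principal_subfield_def by blast
qed

text \<open>Otherwise \<open>x\<close>, the value of the polynomial \<open>X\<close>, would be a
  member, so \<open>h\<close> would divide \<open>X - x\<close> and \<open>h * h\<close> would
  divide \<open>f\<close>.\<close>

lemma principal_subfield_ne_UNIV:
  assumes k: "is_subfield k" and f: "is_min_poly k x f"
    and irr: "irreducible h" and dvd: "[:- x, 1:] * h dvd f"
    and sqf: "\<And>q. \<not> is_unit q \<Longrightarrow> \<not> q * q dvd f"
  shows "principal_subfield k x h \<noteq> UNIV"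
proof
  assume "principal_subfield k x h = UNIV"
  moreover have "[:0, 1:] \<in> polys_over k"
    using k by (simp add: polys_over_pCons_iff polys_over_0 is_subring_0 is_subfield_def)
      (simp add: is_subring_def)
  moreover have "h dvd f" using dvd dvd_mult_right by blast
  ultimately have "h dvd [:0, 1:] - [:poly [:0, 1:] x:]"
    using poly_mem_principal_subfield_iff[OF k f] by blast
  then have "h dvd [:- x, 1:]" by simp
  then have "h * h dvd f" using dvd by (meson dvd_trans dvd_refl mult_dvd_mono)
  then show False using sqf irr irreducible_not_unit by blast
qed

text \<open>The set \<open>J\<close> may be empty: for \<open>K = UNIV\<close> the minimal
  polynomial of \<open>x\<close> over \<open>K\<close> is \<open>X - x\<close>, and the empty
  intersection is \<open>UNIV\<close>.\<close>

lemma subfield_eq_Inter_principal_subfields: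
  assumes k: "is_subfield k" and adj: "adjoin k x = UNIV" and f: "is_min_poly k x f"
    and f_eq: "f = [:- x, 1:] * prod fs I" and I: "finite I"
    and irr: "\<And>\<alpha>. \<alpha> \<in> I \<Longrightarrow> irreducible (fs \<alpha>)"
    and sqf: "\<And>q. \<not> is_unit q \<Longrightarrow> \<not> q * q dvd f"
    and K: "is_subfield K" "k \<subseteq> K"
  obtains J where "J \<subseteq> I" and "K = (\<Inter>\<alpha>\<in>J. principal_subfield k x (fs \<alpha>))"
proof -
  have fK: "f \<in> polys_over K" "f \<noteq> 0" "poly f x = 0"
    using f polys_over_mono[OF K(2)] unfolding is_min_poly_def by auto
  obtain g where g: "is_min_poly K x g" using min_poly_exists[OF K(1) fK] .
  have gf: "g dvd f" using min_poly_dvd[OF K(1) g] fK by blast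
  define lin where "lin = [:- x, 1:]"
  have "lin dvd g" using g by (simp add: lin_def is_min_poly_def poly_eq_0_iff_dvd)
  then obtain h where h: "g = lin * h" by (elim dvdE)
  have "lin \<noteq> 0" by (simp add: lin_def)
  then have h_prod: "h dvd prod fs I" using gf unfolding h f_eq lin_def[symmetric] by simp
  have nunit: "\<not> is_unit (fs \<alpha>)" if "\<alpha> \<in> I" for \<alpha>
    using irr[OF that] by (rule irreducible_not_unit)
  have prime: "prime_elem (fs \<alpha>)" if "\<alpha> \<in> I" for \<alpha>
    using irr[OF that] by (rule field_poly_irreducible_imp_prime)
  have fs_f: "fs \<alpha> dvd f" if "\<alpha> \<in> I" for \<alpha>
    unfolding f_eq by (rule dvd_mult[OF dvd_prodI[OF I that]])
  define J where "J = {\<alpha> \<in> I. fs \<alpha> dvd h}"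
  have lin_prime: "prime_elem lin"
    unfolding lin_def by (rule prime_elem_linear_field_poly) simp
  have mem: "poly p x \<in> K \<longleftrightarrow> (\<forall>\<alpha>\<in>J. poly p x \<in> principal_subfield k x (fs \<alpha>))"
    if p: "p \<in> polys_over k" for p
  proof -
    let ?s = "p - [:poly p x:]"
    have "g dvd ?s \<longleftrightarrow> (\<forall>\<alpha>\<in>J. fs \<alpha> dvd ?s)"
    proof
      assume "g dvd ?s"
      then show "\<forall>\<alpha>\<in>J. fs \<alpha> dvd ?s"
        unfolding J_def h by (auto intro: dvd_trans)
    next
      assume J: "\<forall>\<alpha>\<in>J. fs \<alpha> dvd ?s"
      have "h dvd ?s"
      proof (rule dvd_of_prime_factors_dvd[OF I h_prod prime])
        show "\<not> fs \<alpha> * fs \<alpha> dvd h" if "\<alpha> \<in> I" for \<alpha>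
          using sqf[OF nunit[OF that]] gf unfolding h by (meson dvd_mult dvd_trans)
      qed (use J in \<open>auto simp: J_def\<close>)
      then obtain w where w: "?s = h * w" by (elim dvdE)
      \<comment> \<open>\<open>?s\<close> vanishes at \<open>x\<close>, so the prime
        \<open>lin\<close> divides \<open>h * w\<close>. It does not divide \<open>h\<close>, since
        \<open>f\<close> is squarefree; hence it divides \<open>w\<close>, and
        \<open>h dvd ?s\<close> improves to \<open>g dvd ?s\<close>.\<close>
      have "lin dvd h * w"
        unfolding w[symmetric] lin_def poly_eq_0_iff_dvd[symmetric] by simp
      moreover have "\<not> lin dvd h"
        using sqf[of lin] gf lin_prime unfolding h
        by (meson dvd_refl dvd_trans mult_dvd_mono prime_elem_not_unit)
      ultimately have "lin dvd w" using lin_prime prime_elem_dvd_mult_iff by blast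
      then show "g dvd ?s" unfolding h w by (simp add: mult.commute mult_dvd_mono)
    qed
    moreover have "p \<in> polys_over K" using p polys_over_mono[OF K(2)] by blast
    ultimately show ?thesis
      using mem_iff_min_poly_dvd[OF K(1) g] poly_mem_principal_subfield_iff[OF k f fs_f p]
      unfolding J_def by auto
  qed
  have "y \<in> K \<longleftrightarrow> (\<forall>\<alpha>\<in>J. y \<in> principal_subfield k x (fs \<alpha>))" for y
  proof -
    have "y \<in> adjoin k x" using adj by simp
    then show ?thesis using mem unfolding adjoin_def by blast
  qed
  then have "K = (\<Inter>\<alpha>\<in>J. principal_subfield k x (fs \<alpha>))" by blast
  then show ?thesis using that[of J] unfolding J_def by blast
qed

section \<open>Lengths of chains\<close>

lemma ext_length_ge:
  assumes "\<And>i. i \<le> n \<Longrightarrow> K i \<in> subalgebras k" and "\<And>i. i < n \<Longrightarrow> K i \<subset> K (Suc i)"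
  shows "enat n \<le> ext_length k"
  unfolding ext_length_def using assms by (auto intro!: SUP_upper)

lemma ext_length_le:
  assumes "\<And>n K. (\<And>i. i \<le> n \<Longrightarrow> K i \<in> subalgebras k) \<Longrightarrow>
    (\<And>i. i < n \<Longrightarrow> K i \<subset> K (Suc i)) \<Longrightarrow> n \<le> m"
  shows "ext_length k \<le> enat m"
  unfolding ext_length_def using assms by (force intro!: SUP_least)

lemma ext_length_le_1_if:
  assumes "\<And>A. A \<in> subalgebras k \<Longrightarrow> A = k \<or> A = UNIV"
  shows "ext_length k \<le> 1"
  unfolding one_enat_def
proof (rule ext_length_le)
  fix n and K :: "nat \<Rightarrow> 'a set"
  assume K: "\<And>i. i \<le> n \<Longrightarrow> K i \<in> subalgebras k" "\<And>i. i < n \<Longrightarrow> K i \<subset> K (Suc i)"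
  show "n \<le> 1"
  proof (rule ccontr)
    assume "\<not> n \<le> 1"
    then have "K 0 \<subset> K 1" "K 1 \<subset> K 2" "K 0 \<in> subalgebras k" "K 1 \<in> subalgebras k"
      using K(2)[of 0] K(2)[of 1] K(1)[of 0] K(1)[of 1] by (auto simp: numeral_2_eq_2)
    then show False using assms[of "K 1"] unfolding subalgebras_def by blast
  qed
qed

text \<open>A chain with at least three strict steps yields the pair \<open>K 1\<close>,
  \<open>K 2\<close>: the first is strictly above \<open>k\<close> because of \<open>K 0\<close>,
  the second is proper because of \<open>K 3\<close>. Conversely, a pair \<open>A\<close>,
  \<open>B\<close> extends to the chain \<open>k\<close>, \<open>A\<close>, \<open>B\<close>,
  \<open>UNIV\<close>.\<close>

lemma ext_length_le_2_iff:
  assumes k: "k \<in> subalgebras k"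
  shows "ext_length k \<le> 2 \<longleftrightarrow>
    \<not> (\<exists>A B. A \<in> subalgebras k \<and> B \<in> subalgebras k \<and> k \<subset> A \<and> A \<subset> B \<and> B \<noteq> UNIV)"
proof
  assume le: "ext_length k \<le> 2"
  show "\<not> (\<exists>A B. A \<in> subalgebras k \<and> B \<in> subalgebras k \<and> k \<subset> A \<and> A \<subset> B \<and> B \<noteq> UNIV)"
  proof
    assume "\<exists>A B. A \<in> subalgebras k \<and> B \<in> subalgebras k \<and> k \<subset> A \<and> A \<subset> B \<and> B \<noteq> UNIV"
    then obtain A B where AB: "A \<in> subalgebras k" "B \<in> subalgebras k"
      "k \<subset> A" "A \<subset> B" "B \<noteq> UNIV" by blast
    have U: "UNIV \<in> subalgebras k" by (simp add: subalgebras_def is_subring_def)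
    have "enat 3 \<le> ext_length k"
      by (rule ext_length_ge[where K = "\<lambda>i. [k, A, B, UNIV] ! i"])
        (use k AB U in \<open>auto simp: less_Suc_eq le_Suc_eq numeral_3_eq_3\<close>)
    with le have "enat 3 \<le> 2" by (rule order_trans[rotated])
    then show False by (simp add: numeral_eq_enat)
  qed
next
  assume no: "\<not> (\<exists>A B. A \<in> subalgebras k \<and> B \<in> subalgebras k \<and> k \<subset> A \<and> A \<subset> B \<and> B \<noteq> UNIV)"
  have "ext_length k \<le> enat 2"
  proof (rule ext_length_le)
    fix n and K :: "nat \<Rightarrow> 'a set"
    assume K: "\<And>i. i \<le> n \<Longrightarrow> K i \<in> subalgebras k" "\<And>i. i < n \<Longrightarrow> K i \<subset> K (Suc i)"
    show "n \<le> 2"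
    proof (rule ccontr)
      assume "\<not> n \<le> 2"
      then have "K 0 \<subset> K 1" "K 1 \<subset> K 2" "K 2 \<subset> K 3"
        "K 0 \<in> subalgebras k" "K 1 \<in> subalgebras k" "K 2 \<in> subalgebras k"
        using K(2)[of 0] K(2)[of 1] K(2)[of 2] K(1)[of 0] K(1)[of 1] K(1)[of 2]
        by (auto simp: eval_nat_numeral)
      moreover from this have "k \<subset> K 1" "K 2 \<noteq> UNIV" unfolding subalgebras_def by blast+
      ultimately show False using no by blast
    qed
  qed
  then show "ext_length k \<le> 2" by (simp add: numeral_eq_enat)
qed

text \<open>The order-theoretic core, to be applied with \<open>P\<close> the set of principal
  subfields. \<open>Q\<close> is required to be nonempty because \<open>\<Inter>{}\<close> is
  \<open>UNIV\<close>, so the condition has content only for nonempty families.\<close>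

lemma length_two_from_generating_family:
  assumes k: "is_subfield k" "k \<noteq> UNIV" and fin: "finite P"
    and sub: "P \<subseteq> subalgebras k" and proper: "UNIV \<notin> P"
    and gen: "\<forall>A\<in>subalgebras k - {UNIV}. \<exists>Q\<subseteq>P. Q \<noteq> {} \<and> A = \<Inter>Q"
  shows "ext_length k = 2 \<longleftrightarrow> card P > 1 \<and> (\<forall>A\<in>P. \<forall>B\<in>P. A \<noteq> B \<longrightarrow> A \<inter> B = k)"
    and "ext_length k = 2 \<Longrightarrow> subalgebras k = insert UNIV (insert k P)"
proof -
  have kk: "k \<in> subalgebras k"
    using k by (simp add: subalgebras_def is_subfield_def)
  have U: "UNIV \<in> subalgebras k" by (simp add: subalgebras_def is_subring_def)
  have above: "k \<subseteq> A" if "A \<in> P" for A using sub that unfolding subalgebras_def by blast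
  have Int: "A \<inter> B \<in> subalgebras k" if "A \<in> P" "B \<in> P" for A B
    using sub that unfolding subalgebras_def is_subring_def by blast
  have gen': "\<exists>Q\<subseteq>P. Q \<noteq> {} \<and> A = \<Inter>Q" if "A \<in> subalgebras k" "A \<noteq> UNIV" for A
    using bspec[OF gen, of A] that by simp
  have dir1: "card P > 1 \<and> (\<forall>A\<in>P. \<forall>B\<in>P. A \<noteq> B \<longrightarrow> A \<inter> B = k)" if len: "ext_length k = 2"
  proof
    have no: "\<not> (\<exists>A B. A \<in> subalgebras k \<and> B \<in> subalgebras k \<and> k \<subset> A \<and> A \<subset> B \<and> B \<noteq> UNIV)"
      using len ext_length_le_2_iff[OF kk] by simp
    show "\<forall>A\<in>P. \<forall>B\<in>P. A \<noteq> B \<longrightarrow> A \<inter> B = k"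
    proof (intro ballI impI, rule ccontr)
      fix A B assume AB: "A \<in> P" "B \<in> P" "A \<noteq> B" "A \<inter> B \<noteq> k"
      \<comment> \<open>Distinct \<open>A\<close> and \<open>B\<close> cannot both equal their
        intersection, so it lies strictly between \<open>k\<close> and one of them, which is proper:
        the chain is too long.\<close>
      then have "k \<subset> A \<inter> B" using above by blast
      moreover have "A \<inter> B \<subset> A \<or> A \<inter> B \<subset> B" using AB by blast
      ultimately show False using no AB Int[OF AB(1,2)] sub proper by blast
    qed
    show "card P > 1"
    proof (rule ccontr)
      \<comment> \<open>With at most one member in \<open>P\<close>, every proper subalgebra equals
        that member. As \<open>k\<close> is itself proper, only \<open>k\<close> and
        \<open>UNIV\<close> remain.\<close>
      assume "\<not> card P > 1"
      then have one: "A = B" if "A \<in> P" "B \<in> P" for A B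
        using that fin card_le_Suc0_iff_eq[of P] by auto
      have "\<exists>A\<in>P. X = A" if X: "X \<in> subalgebras k" "X \<noteq> UNIV" for X
      proof -
        obtain Q where Q: "Q \<subseteq> P" "Q \<noteq> {}" "X = \<Inter>Q" using gen'[OF X] by blast
        then obtain A where A: "A \<in> Q" by blast
        then have "Q = {A}" using one Q by blast
        then show ?thesis using A Q by auto
      qed
      then have "X = k \<or> X = UNIV" if "X \<in> subalgebras k" for X
        using that kk k(2) one by metis
      then have "ext_length k \<le> 1" by (rule ext_length_le_1_if)
      then show False using len by simp
    qed
  qed
  have eq: "subalgebras k = insert UNIV (insert k P)"
    if meet: "\<forall>A\<in>P. \<forall>B\<in>P. A \<noteq> B \<longrightarrow> A \<inter> B = k"
  proof
    show "insert UNIV (insert k P) \<subseteq> subalgebras k" using U kk sub by blast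
    show "subalgebras k \<subseteq> insert UNIV (insert k P)"
    proof
      fix X assume X: "X \<in> subalgebras k"
      show "X \<in> insert UNIV (insert k P)"
      proof (cases "X = UNIV")
        case False
        then obtain Q where Q: "Q \<subseteq> P" "Q \<noteq> {}" "X = \<Inter>Q" using gen'[OF X] by blast
        then obtain A where A: "A \<in> Q" by blast
        show ?thesis
        proof (cases "Q = {A}")
          case True
          then show ?thesis using A Q by auto
        next
          case False
          then obtain B where B: "B \<in> Q" "B \<noteq> A" using A by blast
          then have "A \<inter> B = k" using A Q meet by blast
          then have "X \<subseteq> k" using A B Q by blast
          then show ?thesis using X unfolding subalgebras_def by blast
        qed
      qed simp
    qed
  qed
  have dir2: "ext_length k = 2"
    if card: "card P > 1" and meet: "\<forall>A\<in>P. \<forall>B\<in>P. A \<noteq> B \<longrightarrow> A \<inter> B = k"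
  proof (rule antisym)
    \<comment> \<open>Such \<open>A\<close> and \<open>B\<close> would be distinct members of
      \<open>P\<close> with \<open>A \<inter> B = A\<close>, which is not \<open>k\<close>.\<close>
    have "\<not> (\<exists>A B. A \<in> subalgebras k \<and> B \<in> subalgebras k \<and> k \<subset> A \<and> A \<subset> B \<and> B \<noteq> UNIV)"
      using meet unfolding eq[OF meet] by blast
    then show "ext_length k \<le> 2" using ext_length_le_2_iff[OF kk] by blast
    \<comment> \<open>Of two distinct members of \<open>P\<close>, at most one is \<open>k\<close>;
      another one gives a chain with two steps.\<close>
    obtain A where A: "A \<in> P" "A \<noteq> k"
      using card fin card_le_Suc0_iff_eq[of P] by (metis One_nat_def not_less)
    have "enat 2 \<le> ext_length k"
      by (rule ext_length_ge[where K = "\<lambda>i. [k, A, UNIV] ! i"])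
        (use A above[of A] sub U kk proper in
          \<open>auto simp: less_Suc_eq le_Suc_eq numeral_2_eq_2\<close>)
    then show "2 \<le> ext_length k" by (simp add: numeral_eq_enat)
  qed
  show "ext_length k = 2 \<longleftrightarrow> card P > 1 \<and> (\<forall>A\<in>P. \<forall>B\<in>P. A \<noteq> B \<longrightarrow> A \<inter> B = k)"
    using dir1 dir2 by blast
  show "subalgebras k = insert UNIV (insert k P)" if "ext_length k = 2"
    using eq dir1[OF that] by blast
qed

theorem theorem5p14:
  fixes k :: "'a::field set" and x :: 'a and f :: "'a poly"
    and fs :: "nat \<Rightarrow> 'a poly" and r t :: nat and E :: "nat \<Rightarrow> 'a set"
  assumes "is_subfield k"
    and "k \<noteq> UNIV"
    and "finite_extension k"
    and "separable_extension k"
    and "adjoin k x = UNIV"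
    and "is_min_poly k x f"
    and "f = [:- x, 1:] * (\<Prod>\<alpha>\<in>{1..r}. fs \<alpha>)"
    and "\<forall>\<alpha>\<in>{1..r}. lead_coeff (fs \<alpha>) = 1 \<and> irreducible (fs \<alpha>)"
    and "bij_betw E {1..t} ((\<lambda>\<alpha>. principal_subfield k x (fs \<alpha>)) ` {1..r})"
  shows "(ext_length k = 2 \<longleftrightarrow>
            t > 1 \<and> (\<forall>\<alpha>\<in>{1..t}. \<forall>\<beta>\<in>{1..t}. \<alpha> \<noteq> \<beta> \<longrightarrow> E \<alpha> \<inter> E \<beta> = k)) \<and>
         (ext_length k = 2 \<longrightarrow>
            ((\<exists>\<alpha>\<in>{1..t}. k = E \<alpha>) \<longrightarrow> card (subalgebras k) = t + 1) \<and>
            ((\<forall>\<alpha>\<in>{1..t}. k \<noteq> E \<alpha>) \<longrightarrow> card (subalgebras k) = t + 2))"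
proof -
  note k = assms(1) and f = assms(6) and f_eq = assms(7)
  define P where "P = (\<lambda>\<alpha>. principal_subfield k x (fs \<alpha>)) ` {1..r}"
  have E: "inj_on E {1..t}" "E ` {1..t} = P"
    using assms(9) unfolding P_def bij_betw_def by auto
  have card: "card P = t" using card_image[OF E(1)] E(2) by simp
  have fin: "finite P" by (simp add: P_def)
  have irr: "irreducible (fs \<alpha>)" if "\<alpha> \<in> {1..r}" for \<alpha> using assms(8) that by blast
  have sqf: "\<not> q * q dvd f" if "\<not> is_unit q" for q
  proof -
    \<comment> \<open>Separability provides some minimal polynomial \<open>p\<close> of
      \<open>x\<close>, not literally \<open>f\<close>; since \<open>f dvd p\<close>, squarefreeness
      passes to \<open>f\<close>.\<close>
    obtain p where p: "is_min_poly k x p" "coprime p (pderiv p)"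
      using assms(4) unfolding separable_extension_def by blast
    then have "f dvd p" using min_poly_dvd[OF k f] unfolding is_min_poly_def by blast
    then show ?thesis
      using not_dvd_squared_of_coprime_pderiv[OF p(2) that] dvd_trans by blast
  qed
  have sub: "P \<subseteq> subalgebras k"
    unfolding P_def using principal_subfield_in_subalgebras[OF k] by blast
  have "principal_subfield k x (fs \<alpha>) \<noteq> UNIV" if "\<alpha> \<in> {1..r}" for \<alpha>
  proof (rule principal_subfield_ne_UNIV[OF k f irr[OF that] _ sqf])
    show "[:- x, 1:] * fs \<alpha> dvd f"
      unfolding f_eq using that by (intro mult_dvd_mono dvd_refl dvd_prodI) auto
  qed
  then have proper: "UNIV \<notin> P" unfolding P_def by force
  have gen: "\<forall>A\<in>subalgebras k - {UNIV}. \<exists>Q\<subseteq>P. Q \<noteq> {} \<and> A = \<Inter>Q"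
  proof
    fix A assume A: "A \<in> subalgebras k - {UNIV}"
    then have "is_subfield A" "k \<subseteq> A"
      unfolding subalgebras_eq_intermediate_fields[OF k assms(4)] by auto
    then obtain J where J: "J \<subseteq> {1..r}" "A = (\<Inter>\<alpha>\<in>J. principal_subfield k x (fs \<alpha>))"
      using subfield_eq_Inter_principal_subfields[OF k assms(5) f f_eq _ irr sqf] by blast
    \<comment> \<open>\<open>J\<close> is nonempty because \<open>A\<close> is not
      \<open>UNIV\<close>.\<close>
    then show "\<exists>Q\<subseteq>P. Q \<noteq> {} \<and> A = \<Inter>Q"
      using A unfolding P_def
      by (intro exI[of _ "(\<lambda>\<alpha>. principal_subfield k x (fs \<alpha>)) ` J"]) auto
  qed
  note main = length_two_from_generating_family[OF k assms(2) fin sub proper gen]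
  \<comment> \<open>Injectivity of \<open>E\<close> lets distinct indices stand for distinct
    fields.\<close>
  have "(\<forall>\<alpha>\<in>{1..t}. \<forall>\<beta>\<in>{1..t}. E \<alpha> \<noteq> E \<beta> \<longrightarrow> E \<alpha> \<inter> E \<beta> = k) \<longleftrightarrow>
      (\<forall>\<alpha>\<in>{1..t}. \<forall>\<beta>\<in>{1..t}. \<alpha> \<noteq> \<beta> \<longrightarrow> E \<alpha> \<inter> E \<beta> = k)"
    by (intro ball_cong refl) (metis inj_on_eq_iff[OF E(1)])
  then have "(\<forall>A\<in>P. \<forall>B\<in>P. A \<noteq> B \<longrightarrow> A \<inter> B = k) \<longleftrightarrow>
      (\<forall>\<alpha>\<in>{1..t}. \<forall>\<beta>\<in>{1..t}. \<alpha> \<noteq> \<beta> \<longrightarrow> E \<alpha> \<inter> E \<beta> = k)"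
    unfolding E(2)[symmetric] by simp
  then have iff: "ext_length k = 2 \<longleftrightarrow>
      t > 1 \<and> (\<forall>\<alpha>\<in>{1..t}. \<forall>\<beta>\<in>{1..t}. \<alpha> \<noteq> \<beta> \<longrightarrow> E \<alpha> \<inter> E \<beta> = k)"
    using main(1) card by simp
  \<comment> \<open>\<open>UNIV\<close> is neither \<open>k\<close> nor in \<open>P\<close>, so it
    always adds one to the count; \<open>k\<close> adds another one exactly when it is not in
    \<open>P\<close>.\<close>
  have "card (subalgebras k) = Suc (card (insert k P))" if "ext_length k = 2"
    using main(2)[OF that] proper assms(2) fin by simp
  moreover have "(\<exists>\<alpha>\<in>{1..t}. k = E \<alpha>) \<longleftrightarrow> k \<in> P" using E(2) by blast
  moreover have "(\<forall>\<alpha>\<in>{1..t}. k \<noteq> E \<alpha>) \<longleftrightarrow> k \<notin> P" using E(2) by blast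
  ultimately show ?thesis using iff card fin by (simp add: card_insert_if insert_absorb)
qed

end
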